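(* Let $n\ge1$ and let $\mu$ be a Borel probability measure supported on $[0,1]^n$. There are constants $c_1,c_2>0$, an absolute constant $A>0$, and for each integer $N\ge1$ a constant $B_N>0$ depending only on $N$, such that for all $\delta\in(0,1)$, $Q,K\in\mathbb{N}$ and $\gamma\in[0,1]^n$: \[ \mu(A(\delta,Q,\gamma))\le c_1\delta^n\big(1+E_1\big),\qquad |E_1|\le A\sum_{\xi\in\mathbb{Z}^n\setminus\{0\},\,Q\mid\xi,\,|\xi|\le 2Q/\delta}|\hat\mu(\xi)|, \] and \[ \mu(A(\delta,Q,\gamma))\ge c_2\delta^n\big(1+E_2\big)+E_3,\qquad |E_2|\le A\sum_{\xi\in\mathbb{Z}^n\setminus\{0\},\,Q\mid\xi,\,|\xi|\le KQ/\delta}|\hat\mu(\xi)|,\quad |E_3|\le B_NK^{-N}. \]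
   Context: $\|x\|$ is the distance from $x\in\mathbb{R}^n$ to $\mathbb{Z}^n$; $A(\delta,Q,\gamma)=\{x\in\mathbb{R}^n:\|Qx-\gamma\|\le\delta\}$. For $\xi\in\mathbb{Z}^n$, $\hat\mu(\xi)=\int e^{-2\pi i(x,\xi)}d\mu(x)$. $Q\mid\xi$ means $Q$ divides every coordinate of $\xi$. *)

theory Defs
  imports "HOL-Probability.Probability"
begin

text \<open>
  The constants \<open>A\<close> and \<open>B\<^sub>N\<close> of the theorem are uniform in the dimension, so \<open>n\<close> has to be
  quantified inside the formula and cannot be a type.  Vectors of \<open>\<real>\<^sup>n\<close> and \<open>\<int>\<^sup>n\<close> are functions
  on \<open>{..<n}\<close>, extended by \<open>undefined\<close>, as is usual for the product measure.
  As \<open>\<real>\<close> is second countable, the product sigma-algebra is the Borel sigma-algebra of \<open>\<real>\<^sup>n\<close>.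
\<close>

abbreviation Rn :: "nat \<Rightarrow> (nat \<Rightarrow> real) measure" where
  "Rn n \<equiv> Pi\<^sub>M {..<n} (\<lambda>_. borel)"

definition Zn :: "nat \<Rightarrow> (nat \<Rightarrow> int) set" where
  "Zn n = {..<n} \<rightarrow>\<^sub>E UNIV"

definition unit_cube :: "nat \<Rightarrow> (nat \<Rightarrow> real) set" where
  "unit_cube n = {..<n} \<rightarrow>\<^sub>E {0..1}"

definition dist_Zn :: "nat \<Rightarrow> (nat \<Rightarrow> real) \<Rightarrow> real" where
  "dist_Zn n x = (INF m\<in>Zn n. L2_set (\<lambda>i. x i - of_int (m i)) {..<n})"

definition near_lattice :: "nat \<Rightarrow> real \<Rightarrow> nat \<Rightarrow> (nat \<Rightarrow> real) \<Rightarrow> (nat \<Rightarrow> real) set" where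
  "near_lattice n \<delta> Q \<gamma> = {x \<in> space (Rn n). dist_Zn n (\<lambda>i. of_nat Q * x i - \<gamma> i) \<le> \<delta>}"

definition fourier :: "nat \<Rightarrow> (nat \<Rightarrow> real) measure \<Rightarrow> (nat \<Rightarrow> int) \<Rightarrow> complex" where
  "fourier n \<mu> \<xi> =
     (LINT x|\<mu>. exp (- 2 * of_real pi * \<i> * of_real (\<Sum>i<n. x i * of_int (\<xi> i))))"

definition freqs :: "nat \<Rightarrow> nat \<Rightarrow> real \<Rightarrow> (nat \<Rightarrow> int) set" where
  "freqs n Q R = {\<xi> \<in> Zn n. (\<exists>i<n. \<xi> i \<noteq> 0) \<and> (\<forall>i<n. int Q dvd \<xi> i) \<and>
                     L2_set (\<lambda>i. of_int (\<xi> i)) {..<n} \<le> R}"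

text \<open>
  The following two facts guard against junk values: \<open>measure\<close> is \<open>0\<close> outside the
  sigma-algebra, and \<open>sum\<close> is \<open>0\<close> on infinite sets.
\<close>

lemma near_lattice_measurable: "near_lattice n \<delta> Q \<gamma> \<in> sets (Rn n)"
proof -
  have c: "countable (Zn n)"
    unfolding Zn_def by (intro countable_PiE) auto
  have "bdd_below ((\<lambda>m. L2_set (\<lambda>i. of_nat Q * x i - \<gamma> i - of_int (m i)) {..<n}) ` Zn n)" for x
    by (intro bdd_belowI[of _ 0]) auto
  moreover have "(\<lambda>x. L2_set (\<lambda>i. of_nat Q * x i - \<gamma> i - of_int (m i)) {..<n})
      \<in> borel_measurable (Rn n)" for m
    unfolding L2_set_def
    by (intro measurable_compose[OF _ borel_measurable_sqrt] borel_measurable_sum borel_measurable_power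
        borel_measurable_diff borel_measurable_times borel_measurable_const
        measurable_component_singleton)
  ultimately have "(\<lambda>x. dist_Zn n (\<lambda>i. of_nat Q * x i - \<gamma> i)) \<in> borel_measurable (Rn n)"
    unfolding dist_Zn_def using c by (intro borel_measurable_cINF) blast+
  then show ?thesis
    unfolding near_lattice_def by (rule borel_measurable_le[OF _ borel_measurable_const])
qed

lemma finite_freqs: "finite (freqs n Q R)"
proof (rule finite_subset)
  show "freqs n Q R \<subseteq> {..<n} \<rightarrow>\<^sub>E {- \<lceil>R\<rceil>..\<lceil>R\<rceil>}"
  proof
    fix \<xi> assume \<xi>: "\<xi> \<in> freqs n Q R"
    have "\<bar>\<xi> i\<bar> \<le> \<lceil>R\<rceil>" if "i < n" for i
    proof -
      have "\<bar>real_of_int (\<xi> i)\<bar> = L2_set (\<lambda>i. of_int (\<xi> i)) {i}"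
        by (simp add: L2_set_def)
      also have "\<dots> \<le> L2_set (\<lambda>i. of_int (\<xi> i)) {..<n}"
        unfolding L2_set_def using that by (intro real_sqrt_le_mono sum_mono2) auto
      also have "\<dots> \<le> R" using \<xi> by (simp add: freqs_def)
      finally show ?thesis by linarith
    qed
    with \<xi> show "\<xi> \<in> {..<n} \<rightarrow>\<^sub>E {- \<lceil>R\<rceil>..\<lceil>R\<rceil>}"
      by (auto simp: freqs_def Zn_def PiE_iff abs_le_iff minus_le_iff)
  qed
qed (simp add: finite_PiE)

end

theory Submission imports Defs begin

text \<open>
  Put \<open>y = Q x - \<gamma>\<close> and test \<open>\<mu>\<close> against products of one-dimensional squares
  \<open>T\<^sub>a(t) = \<bar>\<Sum>\<^sub>j a\<^sub>j e(j t)\<bar>\<^sup>2\<close>.  Expanding such a product and using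
  \<open>2 \<bar>a\<^sub>f a\<^sub>g\<bar> \<le> a\<^sub>f\<^sup>2 + a\<^sub>g\<^sup>2\<close> off the diagonal, its \<open>\<mu>\<close>-integral differs from its mean \<open>P\<close>
  over the torus by at most \<open>P\<close> times the sum of \<open>\<bar>fourier n \<mu> \<xi>\<bar>\<close>.

  The upper bound follows with the Fejer kernel (\<open>a = 1\<close>) of degree about \<open>1/(n \<delta>)\<close>.
  For the lower bound, \<open>(8 \<delta>\<^sup>2 - \<Sum>\<^sub>i (1 - cos (2 \<pi> y\<^sub>i))) \<Prod>\<^sub>i T\<^sub>a(y\<^sub>i)\<close> is positive only within
  distance \<open>\<delta>\<close> of the lattice.  If \<open>a\<close> is a triangle of width about \<open>n/\<delta>\<close>, the cosine part has small
  mean, since \<open>2 (1 - cos (2 \<pi> t)) T\<^sub>a(t) = T\<^sub>b(t)\<close> with \<open>b\<close> the sequence of differences of \<open>a\<close>.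
  This minorant has all its frequencies below \<open>9 n\<^sup>2/\<delta>\<close>, so no error term is needed when
  \<open>K \<ge> 9 n\<^sup>2\<close>.  For smaller \<open>K\<close> the constant \<open>c\<^sub>2\<close>, which may depend on \<open>n\<close>, is at most
  \<open>exp (- K) \<le> N! / K\<^sup>N\<close> and is absorbed by \<open>E\<^sub>3\<close>.
\<close>

section \<open>Squares of trigonometric polynomials and their integrals against
  \<open>\<mu>\<close>\<close>

definition trig_sq :: "(nat \<Rightarrow> real) \<Rightarrow> nat \<Rightarrow> real \<Rightarrow> real" where
  "trig_sq a m t = (norm (\<Sum>j<m. of_real (a j) * cis (2 * pi * real j * t)))\<^sup>2"

lemma integrable_bounded_prob:
  fixes f :: "_ \<Rightarrow> 'b::{banach, second_countable_topology}"
  assumes "prob_space M" "f \<in> borel_measurable M" "\<And>x. norm (f x) \<le> B"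
  shows "integrable M f"
proof -
  interpret prob_space M by fact
  show ?thesis using assms by (intro integrable_const_bound[of _ B]) auto
qed

lemma Rn_linear_measurable [measurable]:
  "(\<lambda>x. \<Sum>i<n. c i * (u i * x i - v i)) \<in> borel_measurable (Rn n)" for c u v :: "nat \<Rightarrow> real"
  by (intro borel_measurable_sum borel_measurable_times borel_measurable_diff borel_measurable_const
        measurable_component_singleton)

lemma cis_measurable [measurable]: "cis \<in> borel_measurable borel"
  by (intro borel_measurable_continuous_onI continuous_intros)

lemma cnj_measurable [measurable]: "cnj \<in> borel_measurable borel"
  by (intro borel_measurable_continuous_onI continuous_intros)

text \<open>A Schur test. Diagonal pairs integrate to the mean because \<open>\<mu>\<close> has mass
  1; an off-diagonal pair \<open>f\<close>, \<open>g\<close> gives, up to a phase,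
  \<open>a f * a g\<close> times the coefficient at \<open>Q (g - f)\<close>. With one index fixed,
  distinct values of the other give distinct nonzero frequencies, so all row and column sums are at
  most \<open>S\<close>.\<close>

lemma integral_norm_sq_trig_poly:
  fixes a :: "(nat \<Rightarrow> nat) \<Rightarrow> real"
  assumes \<mu>: "prob_space \<mu>" "sets \<mu> = sets (Rn n)"
    and F: "finite F" "F \<subseteq> {..<n} \<rightarrow>\<^sub>E UNIV"
    and Q: "Q \<ge> 1"
    and freq: "\<And>f g. \<lbrakk>f \<in> F; g \<in> F; f \<noteq> g\<rbrakk> \<Longrightarrow>
      (\<lambda>i\<in>{..<n}. int Q * (int (g i) - int (f i))) \<in> freqs n Q R"
  defines "S \<equiv> \<Sum>\<xi>\<in>freqs n Q R. norm (fourier n \<mu> \<xi>)"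
  shows "\<bar>(LINT x|\<mu>. (norm (\<Sum>f\<in>F. of_real (a f) *
            cis (2 * pi * (\<Sum>i<n. real (f i) * (real Q * x i - \<gamma> i)))))\<^sup>2)
          - (\<Sum>f\<in>F. (a f)\<^sup>2)\<bar> \<le> (\<Sum>f\<in>F. (a f)\<^sup>2) * S"
proof -
  interpret prob_space \<mu> by fact
  define D where "D f g = (\<lambda>i\<in>{..<n}. int Q * (int (g i) - int (f i)))" for f g :: "nat \<Rightarrow> nat"
  define p where "p f x = cis (2 * pi * (\<Sum>i<n. real (f i) * (real Q * x i - \<gamma> i)))"
    for f :: "nat \<Rightarrow> nat" and x :: "nat \<Rightarrow> real"
  define W where "W x = (\<Sum>f\<in>F. of_real (a f) * p f x)" for x
  define u where "u f g = cis (- 2 * pi * (\<Sum>i<n. (real (f i) - real (g i)) * \<gamma> i))"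
    for f g :: "nat \<Rightarrow> nat"
  have meas: "p f \<in> borel_measurable \<mu>" for f
    unfolding p_def measurable_cong_sets[OF \<mu>(2) refl] by measurable
  have norm_p [simp]: "norm (p f x) = 1" for f x by (simp add: p_def)
  \<comment> \<open>The minus sign in the exponent of \<open>fourier\<close> is why \<open>D\<close>
    takes \<open>g\<close> minus \<open>f\<close>; the shift by \<open>\<gamma>\<close> contributes
    only the phase \<open>u f g\<close>.\<close>
  have pp: "p f x * cnj (p g x) = u f g *
      exp (- 2 * of_real pi * \<i> * of_real (\<Sum>i<n. x i * of_int (D f g i)))" for f g x
  proof -
    have "exp (- 2 * of_real pi * \<i> * of_real (\<Sum>i<n. x i * of_int (D f g i)))
        = cis (- 2 * pi * (\<Sum>i<n. x i * of_int (D f g i)))"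
      by (simp add: cis_conv_exp mult_ac)
    moreover have "(\<Sum>i<n. real (f i) * (real Q * x i - \<gamma> i)) - (\<Sum>i<n. real (g i) * (real Q * x i - \<gamma> i))
       = - (\<Sum>i<n. (real (f i) - real (g i)) * \<gamma> i) - (\<Sum>i<n. x i * of_int (D f g i))"
      unfolding sum_subtractf[symmetric] sum_negf[symmetric]
      by (intro sum.cong) (auto simp: D_def algebra_simps)
    ultimately show ?thesis
      by (simp add: p_def u_def cis_cnj cis_mult flip: right_diff_distrib distrib_left) 
        (simp add: algebra_simps)
  qed
  have int: "integrable \<mu> (\<lambda>x. of_real (a f * a g) * (p f x * cnj (p g x)))" for f g
    by (intro integrable_mult_right integrable_bounded_prob[OF \<mu>(1), of _ 1])
       (auto intro!: meas borel_measurable_times measurable_compose[OF _ cnj_measurable] simp: norm_mult)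
  have Wexp: "of_real ((norm (W x))\<^sup>2) = (\<Sum>f\<in>F. \<Sum>g\<in>F. of_real (a f * a g) * (p f x * cnj (p g x)))" for x
  proof -
    have "of_real ((norm (W x))\<^sup>2) = W x * cnj (W x)"
      by (rule complex_norm_square)
    then show ?thesis by (simp add: W_def sum_product mult_ac)
  qed
  define h where "h f g = of_real (a f * a g) * (u f g * fourier n \<mu> (D f g))" for f g
  have "of_real (LINT x|\<mu>. (norm (W x))\<^sup>2) = (LINT x|\<mu>. complex_of_real ((norm (W x))\<^sup>2))"
    unfolding integral_complex_of_real ..
  also have "\<dots> = (\<Sum>f\<in>F. \<Sum>g\<in>F. LINT x|\<mu>. of_real (a f * a g) * (p f x * cnj (p g x)))"
    unfolding Wexp using int by (simp add: Bochner_Integration.integral_sum)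
  also have "\<dots> = (\<Sum>f\<in>F. \<Sum>g\<in>F. h f g)"
    unfolding h_def fourier_def pp by (simp add: mult_ac)
  also have "\<dots> = (\<Sum>f\<in>F. h f f + (\<Sum>g\<in>F - {f}. h f g))"
    using F by (intro sum.cong refl) (simp add: sum.remove)
  also have "\<dots> = of_real (\<Sum>f\<in>F. (a f)\<^sup>2) + (\<Sum>f\<in>F. \<Sum>g\<in>F - {f}. h f g)"
  proof -
    have "h f f = of_real ((a f)\<^sup>2)" for f
      by (simp add: h_def u_def fourier_def D_def power2_eq_square prob_space)
    then show ?thesis by (simp add: sum.distrib)
  qed
  finally have eq: "of_real ((LINT x|\<mu>. (norm (W x))\<^sup>2) - (\<Sum>f\<in>F. (a f)\<^sup>2)) =
      (\<Sum>f\<in>F. \<Sum>g\<in>F - {f}. h f g)" by simp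
  define m where "m f g = norm (fourier n \<mu> (D f g))" for f g
  have inj1: "inj_on (D f) F" for f
  proof (rule inj_onI)
    fix g g' assume *: "g \<in> F" "g' \<in> F" "D f g = D f g'"
    have "g i = g' i" if "i < n" for i
      using fun_cong[OF *(3), of i] that Q by (auto simp: D_def)
    with *(1,2) F(2) show "g = g'" by (intro PiE_ext[of g "{..<n}" "\<lambda>_. UNIV" g']) auto
  qed
  have inj2: "inj_on (\<lambda>f. D f g) F" for g
  proof (rule inj_onI)
    fix f f' assume *: "f \<in> F" "f' \<in> F" "D f g = D f' g"
    have "f i = f' i" if "i < n" for i
      using fun_cong[OF *(3), of i] that Q by (auto simp: D_def)
    with *(1,2) F(2) show "f = f'" by (intro PiE_ext[of f "{..<n}" "\<lambda>_. UNIV" f']) auto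
  qed
  have row: "(\<Sum>g\<in>F - {f}. m f g) \<le> S" if "f \<in> F" for f
  proof -
    have "(\<Sum>g\<in>F - {f}. m f g) = (\<Sum>\<xi>\<in>D f ` (F - {f}). norm (fourier n \<mu> \<xi>))"
      unfolding m_def by (subst sum.reindex) (auto intro: inj_on_subset[OF inj1])
    also have "\<dots> \<le> S" unfolding S_def using that freq
      by (intro sum_mono2 finite_freqs) (auto simp: D_def)
    finally show ?thesis .
  qed
  have col: "(\<Sum>f\<in>F - {g}. m f g) \<le> S" if "g \<in> F" for g
  proof -
    have "(\<Sum>f\<in>F - {g}. m f g) = (\<Sum>\<xi>\<in>(\<lambda>f. D f g) ` (F - {g}). norm (fourier n \<mu> \<xi>))"
      unfolding m_def by (subst sum.reindex) (auto intro: inj_on_subset[OF inj2])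
    also have "\<dots> \<le> S" unfolding S_def using that freq
      by (intro sum_mono2 finite_freqs) (auto simp: D_def)
    finally show ?thesis .
  qed
  have amgm: "norm (h f g) \<le> ((a f)\<^sup>2 * m f g + (a g)\<^sup>2 * m f g) / 2" for f g
  proof -
    have "2 * (\<bar>a f\<bar> * \<bar>a g\<bar>) \<le> (a f)\<^sup>2 + (a g)\<^sup>2"
      using sum_squares_bound[of "\<bar>a f\<bar>" "\<bar>a g\<bar>"] by simp
    then have "2 * (\<bar>a f\<bar> * \<bar>a g\<bar>) * m f g \<le> ((a f)\<^sup>2 + (a g)\<^sup>2) * m f g"
      by (intro mult_right_mono) (auto simp: m_def)
    then show ?thesis by (simp add: h_def u_def m_def norm_mult abs_mult algebra_simps)
  qed
  have "\<bar>(LINT x|\<mu>. (norm (W x))\<^sup>2) - (\<Sum>f\<in>F. (a f)\<^sup>2)\<bar> = norm (\<Sum>f\<in>F. \<Sum>g\<in>F - {f}. h f g)"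
    unfolding eq[symmetric] norm_of_real ..
  also have "\<dots> \<le> (\<Sum>f\<in>F. \<Sum>g\<in>F - {f}. ((a f)\<^sup>2 * m f g + (a g)\<^sup>2 * m f g) / 2)"
    by (intro sum_norm_le amgm)
  also have "\<dots> = ((\<Sum>f\<in>F. \<Sum>g\<in>F - {f}. (a f)\<^sup>2 * m f g) + (\<Sum>f\<in>F. \<Sum>g\<in>F - {f}. (a g)\<^sup>2 * m f g)) / 2"
    by (simp add: sum.distrib sum_divide_distrib add_divide_distrib)
  also have "(\<Sum>f\<in>F. \<Sum>g\<in>F - {f}. (a g)\<^sup>2 * m f g) = (\<Sum>g\<in>F. \<Sum>f\<in>F - {g}. (a g)\<^sup>2 * m f g)"
  proof -
    have "(\<Sum>f\<in>F. \<Sum>g\<in>F - {f}. (a g)\<^sup>2 * m f g) = (\<Sum>f\<in>F. \<Sum>g\<in>{g\<in>F. f \<noteq> g}. (a g)\<^sup>2 * m f g)"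
      by (intro sum.cong) auto
    also have "\<dots> = (\<Sum>g\<in>F. \<Sum>f\<in>{f\<in>F. f \<noteq> g}. (a g)\<^sup>2 * m f g)"
      using F(1) by (intro sum.swap_restrict) auto
    also have "\<dots> = (\<Sum>g\<in>F. \<Sum>f\<in>F - {g}. (a g)\<^sup>2 * m f g)"
      by (intro sum.cong) auto
    finally show ?thesis .
  qed
  also have "((\<Sum>f\<in>F. \<Sum>g\<in>F - {f}. (a f)\<^sup>2 * m f g) + (\<Sum>g\<in>F. \<Sum>f\<in>F - {g}. (a g)\<^sup>2 * m f g)) / 2
      \<le> ((\<Sum>f\<in>F. (a f)\<^sup>2 * S) + (\<Sum>g\<in>F. (a g)\<^sup>2 * S)) / 2"
    unfolding sum_distrib_left[symmetric]
    by (intro divide_right_mono add_mono sum_mono mult_left_mono row col) auto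
  also have "\<dots> = (\<Sum>f\<in>F. (a f)\<^sup>2) * S"
    by (simp add: sum_distrib_right)
  finally show ?thesis by (simp add: W_def p_def)
qed


lemma trig_sq_nonneg: "trig_sq a m t \<ge> 0"
  by (simp add: trig_sq_def)

lemma trig_sq_le: "trig_sq a m t \<le> (\<Sum>j<m. \<bar>a j\<bar>)\<^sup>2"
  unfolding trig_sq_def
  by (intro power_mono sum_norm_le) (auto simp: norm_mult)

lemma trig_sq_measurable [measurable]: "trig_sq a m \<in> borel_measurable borel"
  unfolding trig_sq_def by (intro borel_measurable_continuous_onI continuous_intros)

lemma trig_sq_shift: "trig_sq a m (t - of_int k) = trig_sq a m t"
proof -
  have "cis (2 * pi * real j * (t - of_int k)) = cis (2 * pi * real j * t)" for j
  proof -
    have "cis (2 * pi * real j * t) = cis (2 * pi * real j * (t - of_int k)) * cis (2 * pi * (real j * of_int k))"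
      unfolding cis_mult by (simp add: algebra_simps)
    then show ?thesis by simp
  qed
  then show ?thesis by (simp add: trig_sq_def)
qed

lemma integrable_prod_trig_sq:
  assumes "prob_space \<mu>" "sets \<mu> = sets (Rn n)"
  shows "integrable \<mu> (\<lambda>x. \<Prod>i<n. trig_sq (a i) m (u * x i - v i))"
proof (intro integrable_bounded_prob[OF assms(1), of _ "\<Prod>i<n. (\<Sum>j<m. \<bar>a i j\<bar>)\<^sup>2"])
  have "(\<lambda>x. \<Prod>i<n. trig_sq (a i) m (u * x i - v i)) \<in> borel_measurable (Rn n)"
    by (intro borel_measurable_prod measurable_compose[OF _ trig_sq_measurable] borel_measurable_times
        borel_measurable_diff borel_measurable_const measurable_component_singleton)
  then show "(\<lambda>x. \<Prod>i<n. trig_sq (a i) m (u * x i - v i)) \<in> borel_measurable \<mu>"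
    using measurable_cong_sets[OF assms(2) refl] by blast
  show "norm (\<Prod>i<n. trig_sq (a i) m (u * x i - v i)) \<le> (\<Prod>i<n. (\<Sum>j<m. \<bar>a i j\<bar>)\<^sup>2)" for x
    unfolding prod_norm[symmetric] by (intro prod_mono) (auto simp: trig_sq_nonneg trig_sq_le)
qed

text \<open>By distributivity the product is the square of a single polynomial indexed by the box
  \<open>F\<close>. Indices differ by less than \<open>m\<close> in each coordinate, whence the
  condition on \<open>R\<close>. The sequence may vary with the coordinate because the lower bound
  changes it in just one.\<close>

lemma integral_prod_trig_sq:
  fixes a :: "nat \<Rightarrow> nat \<Rightarrow> real"
  assumes \<mu>: "prob_space \<mu>" "sets \<mu> = sets (Rn n)"
    and Q: "Q \<ge> 1" and R: "real n * real m * real Q \<le> R"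
  shows "\<bar>(LINT x|\<mu>. (\<Prod>i<n. trig_sq (a i) m (real Q * x i - \<gamma> i))) - (\<Prod>i<n. \<Sum>j<m. (a i j)\<^sup>2)\<bar>
    \<le> (\<Prod>i<n. \<Sum>j<m. (a i j)\<^sup>2) * (\<Sum>\<xi>\<in>freqs n Q R. norm (fourier n \<mu> \<xi>))"
proof -
  define F where "F = {..<n} \<rightarrow>\<^sub>E {..<m}"
  have freq: "(\<lambda>i\<in>{..<n}. int Q * (int (g i) - int (f i))) \<in> freqs n Q R"
    if "f \<in> F" "g \<in> F" "f \<noteq> g" for f g
  proof -
    let ?\<xi> = "\<lambda>i\<in>{..<n}. int Q * (int (g i) - int (f i))"
    have "\<exists>i<n. f i \<noteq> g i" using that PiE_ext[of f "{..<n}" "\<lambda>_. {..<m}" g] by (auto simp: F_def)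
    moreover have "L2_set (\<lambda>i. of_int (?\<xi> i)) {..<n} \<le> R"
    proof -
      have "L2_set (\<lambda>i. of_int (?\<xi> i)) {..<n} \<le> (\<Sum>i<n. \<bar>of_int (?\<xi> i)\<bar>)"
        by (rule L2_set_le_sum_abs)
      also have "\<dots> \<le> (\<Sum>i<n. real Q * real m)"
      proof (intro sum_mono)
        fix i assume i: "i \<in> {..<n}"
        then have "f i < m" "g i < m" using that by (auto simp: F_def)
        then have "real Q * \<bar>real (g i) - real (f i)\<bar> \<le> real Q * real m"
          by (intro mult_left_mono) auto
        then show "\<bar>real_of_int (?\<xi> i)\<bar> \<le> real Q * real m" using i by (simp add: abs_mult)
      qed
      also have "\<dots> \<le> R" using R by (simp add: mult_ac)
      finally show ?thesis .
    qed
    moreover have "?\<xi> \<in> Zn n" unfolding Zn_def by simp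
    moreover have "\<forall>i<n. int Q dvd ?\<xi> i" by simp
    moreover have "?\<xi> i \<noteq> 0" if "i < n" "f i \<noteq> g i" for i using that Q by simp
    ultimately show ?thesis unfolding freqs_def by blast
  qed
  have expand: "(\<Prod>i<n. trig_sq (a i) m (real Q * x i - \<gamma> i)) =
     (norm (\<Sum>f\<in>F. of_real (\<Prod>i<n. a i (f i)) *
            cis (2 * pi * (\<Sum>i<n. real (f i) * (real Q * x i - \<gamma> i)))))\<^sup>2" for x
  proof -
    have cis_sum: "cis (\<Sum>i<k. t i) = (\<Prod>i<k. cis (t i))" for k :: nat and t
      by (induction k) (simp_all add: cis_mult[symmetric])
    have "(\<Prod>i<n. trig_sq (a i) m (real Q * x i - \<gamma> i)) =
      (norm (\<Prod>i<n. \<Sum>j<m. of_real (a i j) * cis (2 * pi * real j * (real Q * x i - \<gamma> i))))\<^sup>2"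
      by (simp add: trig_sq_def prod_norm[symmetric] prod_power_distrib)
    also have "(\<Prod>i<n. \<Sum>j<m. of_real (a i j) * cis (2 * pi * real j * (real Q * x i - \<gamma> i)))
       = (\<Sum>f\<in>F. \<Prod>i<n. of_real (a i (f i)) * cis (2 * pi * real (f i) * (real Q * x i - \<gamma> i)))"
      unfolding F_def by (intro prod_sum_PiE) auto
    also have "\<dots> = (\<Sum>f\<in>F. of_real (\<Prod>i<n. a i (f i)) *
            cis (2 * pi * (\<Sum>i<n. real (f i) * (real Q * x i - \<gamma> i))))"
      by (simp add: prod.distrib cis_sum sum_distrib_left mult.assoc)
    finally show ?thesis .
  qed
  have diag: "(\<Prod>i<n. \<Sum>j<m. (a i j)\<^sup>2) = (\<Sum>f\<in>F. (\<Prod>i<n. a i (f i))\<^sup>2)"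
    unfolding F_def prod_power_distrib by (intro prod_sum_PiE) auto
  have "finite F" "F \<subseteq> {..<n} \<rightarrow>\<^sub>E UNIV"
    unfolding F_def by (auto intro: finite_PiE)
  then show ?thesis
    unfolding expand diag by (intro integral_norm_sq_trig_poly \<mu> Q freq)
qed

section \<open>Upper bound by the Fejer kernel\<close>

text \<open>All phases \<open>2 * pi * j * t\<close> lie within \<open>pi / 3\<close> of 0, so each
  summand has real part at least 1/2.\<close>

lemma trig_sq_const_ge:
  assumes "real m * \<bar>t\<bar> \<le> 1/6"
  shows "trig_sq (\<lambda>_. 1) m t \<ge> (real m)\<^sup>2 / 4"
proof -
  let ?z = "\<Sum>j<m. of_real 1 * cis (2 * pi * real j * t)"
  have "cos (2 * pi * real j * t) \<ge> 1/2" if "j < m" for j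
  proof -
    have "real j * \<bar>t\<bar> \<le> real m * \<bar>t\<bar>" using that by (intro mult_right_mono) auto
    with assms have "(2 * pi) * (real j * \<bar>t\<bar>) \<le> (2 * pi) * (1/6)"
      by (intro mult_left_mono) auto
    then have "cos (pi / 3) \<le> cos \<bar>2 * pi * real j * t\<bar>"
      by (intro cos_monotone_0_pi_le) (auto simp: abs_mult mult_ac)
    then show ?thesis by (simp add: cos_60)
  qed
  then have "(\<Sum>j<m. 1/2) \<le> (\<Sum>j<m. cos (2 * pi * real j * t))" by (intro sum_mono) auto
  also have "\<dots> = Re ?z" by simp
  also have "\<dots> \<le> norm ?z" by (rule complex_Re_le_cmod)
  finally have "(real m / 2)\<^sup>2 \<le> (norm ?z)\<^sup>2" by (intro power_mono) auto
  then show ?thesis by (simp add: trig_sq_def power_divide)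
qed

text \<open>The distance is an infimum; the slack from \<open>\<delta>\<close> to
  \<open>2 * \<delta>\<close> yields a lattice point without showing that the infimum is
  attained.\<close>

lemma near_latticeE:
  assumes "x \<in> near_lattice n \<delta> Q \<gamma>" "\<delta> > 0"
  obtains k :: "nat \<Rightarrow> int" where "\<And>i. i < n \<Longrightarrow> \<bar>real Q * x i - \<gamma> i - of_int (k i)\<bar> \<le> 2 * \<delta>"
proof -
  let ?d = "\<lambda>m. L2_set (\<lambda>i. real Q * x i - \<gamma> i - of_int (m i)) {..<n}"
  have ne: "Zn n \<noteq> {}" by (simp add: Zn_def PiE_eq_empty_iff)
  have "(INF m\<in>Zn n. ?d m) < 2 * \<delta>"
    using assms by (simp add: near_lattice_def dist_Zn_def)
  moreover have "bdd_below (?d ` Zn n)" by (intro bdd_belowI[of _ 0]) auto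
  ultimately obtain k where k: "?d k < 2 * \<delta>" using ne by (auto simp: cINF_less_iff)
  show ?thesis
  proof (rule that[of k])
    fix i assume "i < n"
    then have "norm (real Q * x i - \<gamma> i - of_int (k i)) \<le> ?d k"
      using member_le_L2_set[of "{..<n}" i "\<lambda>i. \<bar>real Q * x i - \<gamma> i - of_int (k i)\<bar>"]
      by (simp add: L2_set_def)
    with k show "\<bar>real Q * x i - \<gamma> i - of_int (k i)\<bar> \<le> 2 * \<delta>" by simp
  qed
qed

lemma measure_near_lattice_le:
  assumes \<mu>: "prob_space \<mu>" "sets \<mu> = sets (Rn n)"
    and n: "n \<ge> 1" and \<delta>: "0 < \<delta>" and Q: "Q \<ge> 1"
  shows "measure \<mu> (near_lattice n \<delta> Q \<gamma>) \<le> (96 * real n) ^ n * \<delta> ^ n *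
    (1 + (\<Sum>\<xi>\<in>freqs n Q (2 * real Q / \<delta>). norm (fourier n \<mu> \<xi>)))"
proof -
  interpret prob_space \<mu> by fact
  define S where "S = (\<Sum>\<xi>\<in>freqs n Q (2 * real Q / \<delta>). norm (fourier n \<mu> \<xi>))"
  have S: "S \<ge> 0" unfolding S_def by (intro sum_nonneg) auto
  let ?A = "near_lattice n \<delta> Q \<gamma>"
  have A: "?A \<in> sets \<mu>" using near_lattice_measurable \<mu>(2) by simp
  \<comment> \<open>For degree \<open>M \<le> X\<close>, points within \<open>2 * \<delta>\<close>
    of the integers meet the hypothesis of \<open>trig_sq_const_ge\<close>, and the frequencies are
    at most \<open>n * X * Q = Q / (12 * \<delta>)\<close>.\<close>
  define X where "X = 1 / (12 * real n * \<delta>)"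
  have X: "X > 0" "12 * real n * \<delta> * X = 1" using n \<delta> by (auto simp: X_def)
  show ?thesis
  \<comment> \<open>If \<open>X < 1\<close> no positive degree is available, but then
    \<open>\<delta>\<close> is so large that the claimed bound is at least 1.\<close>
  proof (cases "X < 1")
    case True
    then have "1 \<le> 96 * real n * \<delta>" using n \<delta> by (simp add: X_def field_simps)
    then have "1 * 1 \<le> (96 * real n * \<delta>) ^ n * (1 + S)"
      using S n \<delta> by (intro mult_mono one_le_power) auto
    then show ?thesis by (intro order_trans[OF prob_le_1[of ?A]]) (simp add: S_def power_mult_distrib)
  next
    case False
    define M where "M = nat \<lfloor>X\<rfloor>"
    \<comment> \<open>Since \<open>X \<ge> 1\<close>, rounding down loses at most a factor 2. The
      final ratio \<open>4 / M\<close> is thus at most \<open>8 / X\<close>, which is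
      \<open>96 * n * \<delta>\<close>.\<close>
    have M: "real M \<le> X" "X / 2 \<le> real M" "M \<ge> 1"
    proof -
      have "1 \<le> \<lfloor>X\<rfloor>" using False by simp
      then show "real M \<le> X" "X / 2 \<le> real M" "M \<ge> 1" unfolding M_def by linarith+
    qed
    let ?G = "\<lambda>x. \<Prod>i<n. trig_sq (\<lambda>_. 1) M (real Q * x i - \<gamma> i)"
    have ge: "((real M)\<^sup>2 / 4) ^ n * indicator ?A x \<le> ?G x" for x
    proof (cases "x \<in> ?A")
      case True
      then obtain k where k: "\<And>i. i < n \<Longrightarrow> \<bar>real Q * x i - \<gamma> i - of_int (k i)\<bar> \<le> 2 * \<delta>"
        using \<delta> by (elim near_latticeE) auto
      have "(real M)\<^sup>2 / 4 \<le> trig_sq (\<lambda>_. 1) M (real Q * x i - \<gamma> i)" if "i < n" for i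
      proof -
        have "real M * \<bar>real Q * x i - \<gamma> i - of_int (k i)\<bar> \<le> X * (2 * \<delta>)"
          using k[OF that] M \<delta> X by (intro mult_mono) auto
        also have "\<dots> \<le> 1/6"
        proof -
          have "X * \<delta> * 12 * 1 \<le> X * \<delta> * 12 * real n" using X \<delta> n by (intro mult_left_mono) auto
          also have "\<dots> = 1" using X by (simp add: mult_ac)
          finally show ?thesis by simp
        qed
        finally show ?thesis using trig_sq_const_ge trig_sq_shift by metis
      qed
      then have "(\<Prod>i<n. (real M)\<^sup>2 / 4) \<le> ?G x" by (intro prod_mono) auto
      then show ?thesis using True by simp
    qed (auto intro: prod_nonneg trig_sq_nonneg)
    have "measure \<mu> ?A * ((real M)\<^sup>2 / 4) ^ n = (LINT x|\<mu>. ((real M)\<^sup>2 / 4) ^ n * indicator ?A x)"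
      using A by (simp add: Int_absorb1 sets.sets_into_space)
    also have "\<dots> \<le> (LINT x|\<mu>. ?G x)"
      using A by (intro integral_mono integrable_prod_trig_sq \<mu> ge)
        (auto intro!: integrable_real_indicator simp: less_top[symmetric])
    also have "\<dots> \<le> real M ^ n + real M ^ n * S"
    proof -
      have "real n * real M * real Q \<le> 2 * real Q / \<delta>"
      proof -
        have "real n * real M * real Q \<le> real n * X * real Q"
          using M by (intro mult_mono) auto
        also have "\<dots> \<le> 2 * real Q / \<delta>" using n \<delta> by (simp add: X_def field_simps)
        finally show ?thesis .
      qed
      from integral_prod_trig_sq[OF \<mu> Q this, of "\<lambda>_ _. 1" \<gamma>]
      show ?thesis by (simp add: S_def)
    qed
    finally have *: "measure \<mu> ?A * ((real M)\<^sup>2 / 4) ^ n \<le> real M ^ n * (1 + S)"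
      by (simp add: algebra_simps)
    have "real M ^ n = ((real M)\<^sup>2 / 4) ^ n * (4 / real M) ^ n"
      using M(3) by (simp add: power_mult_distrib[symmetric] power2_eq_square)
    with * M(3) have "measure \<mu> ?A \<le> (4 / real M) ^ n * (1 + S)"
      by (simp add: mult.commute mult.left_commute)
    also have "\<dots> \<le> (96 * real n * \<delta>) ^ n * (1 + S)"
    proof (intro mult_right_mono power_mono)
      have "96 * real n * \<delta> * (X/2) \<le> 96 * real n * \<delta> * real M"
        using M \<delta> by (intro mult_left_mono) auto
      then show "4 / real M \<le> 96 * real n * \<delta>" using X M(3) by (simp add: field_simps)
    qed (use S in auto)
    finally show ?thesis by (simp add: S_def power_mult_distrib)
  qed
qed

section \<open>Lower bound by a trigonometric minorant\<close>

text \<open>The left side is \<open>2 * (sin (pi * t))\<^sup>2\<close>, and the concave sine lies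
  above its chord from 0 to \<open>pi / 2\<close>.\<close>

lemma one_minus_cos_ge:
  assumes "\<bar>t\<bar> \<le> 1/2"
  shows "1 - cos (2 * pi * t) \<ge> 8 * t\<^sup>2"
proof -
  have "convex_on {0..pi} (\<lambda>x::real. - sin x)"
    by (rule f''_ge0_imp_convex[where f' = "\<lambda>x. - cos x" and f'' = sin])
       (auto intro!: derivative_eq_intros sin_ge_zero)
  from convex_onD[OF this, of "2 * \<bar>t\<bar>" 0 "pi/2"] assms
  have "2 * \<bar>t\<bar> \<le> sin (pi * \<bar>t\<bar>)" by (simp add: mult_ac)
  then have "(2 * \<bar>t\<bar>)\<^sup>2 \<le> (sin (pi * \<bar>t\<bar>))\<^sup>2" by (intro power_mono) auto
  moreover have "(sin (pi * \<bar>t\<bar>))\<^sup>2 = (sin (pi * t))\<^sup>2" by (simp add: abs_if)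
  moreover have "cos (2 * (pi * t)) = 1 - 2 * (sin (pi * t))\<^sup>2" by (rule cos_double_sin)
  ultimately show ?thesis by (simp add: mult_ac power_mult_distrib)
qed

text \<open>Summation by parts: multiplying by \<open>1 - cis (2 * pi * t)\<close> differences the
  coefficients. At \<open>j = 0\<close> the truncated \<open>j - 1\<close> makes the difference 0,
  in agreement with \<open>a 0 = 0\<close>; \<open>a m = 0\<close> removes the boundary term of
  degree \<open>Suc m\<close>.\<close>

lemma trig_sq_diff:
  assumes "a 0 = 0" "a m = 0"
  shows "trig_sq (\<lambda>j. a j - a (j - 1)) (Suc m) t = (2 - 2 * cos (2 * pi * t)) * trig_sq a (Suc m) t"
proof -
  let ?z = "cis (2 * pi * t)"
  have pow: "cis (2 * pi * real j * t) = ?z ^ j" for j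
    using Complex.DeMoivre[of "2 * pi * t" j] by (simp add: mult_ac)
  have "(\<Sum>j<Suc k. complex_of_real (a j - a (j - 1)) * ?z ^ j)
      = (1 - ?z) * (\<Sum>j<Suc k. complex_of_real (a j) * ?z ^ j) + of_real (a k) * ?z ^ Suc k" for k
    using assms(1) by (induction k) (simp_all add: algebra_simps)
  from this[of m] assms(2)
  have "trig_sq (\<lambda>j. a j - a (j - 1)) (Suc m) t = (norm (1 - ?z))\<^sup>2 * trig_sq a (Suc m) t"
    unfolding trig_sq_def pow by (simp add: norm_mult power_mult_distrib)
  also have "(norm (1 - ?z))\<^sup>2 = 2 - 2 * cos (2 * pi * t)"
    using sin_cos_squared_add[of "2 * pi * t"]
    unfolding cmod_power2 by (simp add: power2_eq_square algebra_simps)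
  finally show ?thesis .
qed

text \<open>Rounding each coordinate of \<open>Q x - \<gamma>\<close> gives one candidate in the
  infimum, so its distance exceeds \<open>\<delta>\<close>. The offsets are at most 1/2, where
  \<open>one_minus_cos_ge\<close> applies, and the cosine ignores the integer parts.\<close>

lemma not_near_latticeD:
  assumes "x \<in> space (Rn n)" "x \<notin> near_lattice n \<delta> Q \<gamma>" "\<delta> > 0"
  shows "(\<Sum>i<n. 1 - cos (2 * pi * (real Q * x i - \<gamma> i))) \<ge> 8 * \<delta>\<^sup>2"
proof -
  define y where "y i = real Q * x i - \<gamma> i" for i
  define k where "k = (\<lambda>i\<in>{..<n}. round (y i))"
  have "\<delta> < dist_Zn n y" using assms by (simp add: near_lattice_def y_def[abs_def])
  also have "k \<in> Zn n" unfolding Zn_def k_def by simp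
  then have "dist_Zn n y \<le> L2_set (\<lambda>i. y i - of_int (k i)) {..<n}"
    unfolding dist_Zn_def by (intro cINF_lower bdd_belowI[of _ 0]) auto
  finally have "\<delta>\<^sup>2 \<le> (L2_set (\<lambda>i. y i - of_int (k i)) {..<n})\<^sup>2"
    using assms(3) by (intro power_mono) auto
  also have "\<dots> = (\<Sum>i<n. (y i - of_int (k i))\<^sup>2)"
    by (simp add: L2_set_def sum_nonneg)
  finally have "8 * \<delta>\<^sup>2 \<le> (\<Sum>i<n. 8 * (y i - of_int (k i))\<^sup>2)"
    by (simp add: sum_distrib_left[symmetric])
  also have "\<dots> \<le> (\<Sum>i<n. 1 - cos (2 * pi * y i))"
  proof (intro sum_mono)
    fix i assume "i \<in> {..<n}"
    then have "\<bar>y i - of_int (k i)\<bar> \<le> 1/2"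
      using of_int_round_abs_le[of "y i"] by (simp add: k_def abs_minus_commute)
    from one_minus_cos_ge[OF this]
    have "8 * (y i - of_int (k i))\<^sup>2 \<le> 1 - cos (2 * pi * y i - 2 * pi * of_int (k i))"
      by (simp add: algebra_simps)
    also have "\<dots> = 1 - cos (2 * pi * y i)"
      by (simp add: cos_diff)
    finally show "8 * (y i - of_int (k i))\<^sup>2 \<le> 1 - cos (2 * pi * y i)" .
  qed
  finally show ?thesis by (simp add: y_def)
qed


lemma sum_squares_ge: "(\<Sum>j<Suc L. (real j)\<^sup>2) \<ge> real L ^ 3 / 3"
proof (induction L)
  case (Suc L)
  have "real (Suc L) ^ 3 / 3 \<le> real L ^ 3 / 3 + (real (Suc L))\<^sup>2"
    by (simp add: power2_eq_square power3_eq_cube algebra_simps)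
  with Suc show ?case by simp
qed simp

text \<open>The test function \<open>G\<close> is at most
  \<open>\<epsilon> * (s\<^sup>2) ^ n\<close> on the set and nonpositive off it, so its integral
  bounds the measure from below. The identity
  \<open>(1 - S) - (1 + S) / 3 = (2/3) * (1 - 2 * S)\<close> explains the factors 2/3 and 2.\<close>

lemma measure_near_lattice_ge:
  assumes \<mu>: "prob_space \<mu>" "sets \<mu> = sets (Rn n)"
    and n: "n \<ge> 1" and \<delta>: "0 < \<delta>" "\<delta> < 1" and Q: "Q \<ge> 1"
    and R: "9 * (real n)\<^sup>2 * real Q / \<delta> \<le> R"
  shows "measure \<mu> (near_lattice n \<delta> Q \<gamma>) \<ge> (2/3) * (\<delta> / (81 * real n)) ^ n *
    (1 - 2 * (\<Sum>\<xi>\<in>freqs n Q R. norm (fourier n \<mu> \<xi>)))"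
proof -
  interpret prob_space \<mu> by fact
  define S where "S = (\<Sum>\<xi>\<in>freqs n Q R. norm (fourier n \<mu> \<xi>))"
  let ?A = "near_lattice n \<delta> Q \<gamma>"
  have A: "?A \<in> sets \<mu>" using near_lattice_measurable \<mu>(2) by simp
  \<comment> \<open>\<open>L * \<delta> \<ge> 2 * n\<close> is what \<open>gap\<close> needs;
    rounding up keeps \<open>L\<close> below \<open>3 * n / \<delta>\<close> because
    \<open>n / \<delta> \<ge> 1\<close>.\<close>
  define L where "L = nat \<lceil>2 * real n / \<delta>\<rceil>"
  have nd: "real n / \<delta> \<ge> 1" using n \<delta> by (simp add: field_simps)
  have L: "2 * real n / \<delta> \<le> real L" "real L \<le> 3 * real n / \<delta>" "L \<ge> 1"
    using nd unfolding L_def by linarith+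
  \<comment> \<open>A triangle with peak \<open>L\<close> at \<open>j = L\<close>. It vanishes at 0
    and \<open>2 * L\<close>, as \<open>trig_sq_diff\<close> demands; \<open>m\<close> is chosen to
    include the index \<open>2 * L\<close>.\<close>
  define a where "a j = real (min j (2 * L - j))" for j
  define b where "b j = a j - a (j - 1)" for j
  define m where "m = Suc (2 * L)"
  define \<epsilon> where "\<epsilon> = 8 * \<delta>\<^sup>2"
  define Na where "Na = (\<Sum>j<m. (a j)\<^sup>2)"
  define Nb where "Nb = (\<Sum>j<m. (b j)\<^sup>2)"
  define s where "s = (\<Sum>j<m. \<bar>a j\<bar>)"
  have \<epsilon>: "\<epsilon> > 0" using \<delta> by (simp add: \<epsilon>_def)
  have Na: "Na \<ge> real L ^ 3 / 3"
  proof -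
    \<comment> \<open>Only the rising half of the triangle is kept.\<close>
    have "(\<Sum>j<Suc L. (real j)\<^sup>2) = (\<Sum>j<Suc L. (a j)\<^sup>2)"
      by (intro sum.cong) (auto simp: a_def)
    also have "\<dots> \<le> Na" unfolding Na_def m_def by (intro sum_mono2) auto
    finally show ?thesis using sum_squares_ge[of L] by linarith
  qed
  have Na0: "Na > 0" by (rule less_le_trans[OF _ Na]) (use L in simp)
  have Nb: "Nb \<le> 3 * real L"
  proof -
    have "\<bar>b j\<bar> \<le> 1" for j by (auto simp: b_def a_def min_def)
    then have "(b j)\<^sup>2 \<le> 1" for j by (simp add: abs_square_le_1)
    then have "Nb \<le> (\<Sum>j<m. 1)" unfolding Nb_def by (intro sum_mono) auto
    also have "\<dots> \<le> 3 * real L" using L by (simp add: m_def)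
    finally show ?thesis .
  qed
  have s: "s \<le> 3 * (real L)\<^sup>2" "s > 0"
  proof -
    have "s \<le> (\<Sum>j<m. real L)" unfolding s_def by (intro sum_mono) (auto simp: a_def)
    also have "\<dots> \<le> 3 * real L * real L"
      using L unfolding m_def by (simp add: distrib_right)
    finally show "s \<le> 3 * (real L)\<^sup>2" by (simp add: power2_eq_square mult_ac)
    have "\<bar>a 1\<bar> \<le> s" unfolding s_def using L by (intro member_le_sum) (auto simp: m_def)
    then show "s > 0" using L by (simp add: a_def)
  qed
  \<comment> \<open>That is, \<open>n * Nb / 2 \<le> \<epsilon> * Na / 3\<close>: the cosine part
    costs at most a third of the mean. \<open>Na\<close> grows like \<open>L ^ 3\<close>, but
    \<open>Nb\<close> only like \<open>L\<close>.\<close>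
  have gap: "3 * real n * Nb \<le> 2 * \<epsilon> * Na"
  proof -
    have d: "2 * real n \<le> real L * \<delta>" using L \<delta> by (simp add: field_simps)
    then have "(2 * real n)\<^sup>2 \<le> (real L * \<delta>)\<^sup>2" by (intro power_mono) auto
    moreover have "4 * real n \<le> (2 * real n)\<^sup>2" using n by (simp add: power2_eq_square)
    ultimately have "4 * real n \<le> (real L)\<^sup>2 * \<delta>\<^sup>2" unfolding power_mult_distrib by linarith
    then have *: "4 * real n * (16/3 * real L) \<le> (real L)\<^sup>2 * \<delta>\<^sup>2 * (16/3 * real L)"
      by (intro mult_right_mono) auto
    have "3 * real n * Nb \<le> 3 * real n * (3 * real L)"
      using Nb by (intro mult_left_mono) auto
    also have "\<dots> \<le> 4 * real n * (16/3 * real L)" by simp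
    also have "\<dots> \<le> 2 * \<epsilon> * (real L ^ 3 / 3)"
      using * by (simp add: \<epsilon>_def power2_eq_square power3_eq_cube mult_ac)
    also have "\<dots> \<le> 2 * \<epsilon> * Na" using Na \<epsilon> by (intro mult_left_mono) auto
    finally show ?thesis .
  qed
  have R': "real n * real m * real Q \<le> R"
  proof -
    have "real m \<le> 9 * real n / \<delta>" using L nd by (simp add: m_def)
    then have "real n * real m * real Q \<le> real n * (9 * real n / \<delta>) * real Q"
      by (intro mult_right_mono mult_left_mono) auto
    also have "\<dots> = 9 * (real n)\<^sup>2 * real Q / \<delta>" by (simp add: power2_eq_square)
    finally show ?thesis using R by linarith
  qed
  \<comment> \<open>\<open>P' k\<close> has the difference sequence in coordinate \<open>k\<close>
    only. It is again a product of squares, so \<open>integral_prod_trig_sq\<close> covers it, and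
    it equals \<open>P\<close> times \<open>2 - 2 * cos (2 * pi * y x k)\<close>; hence the division
    by 2 in \<open>G\<close>.\<close>
  define c where "c k i = (if i = k then b else a)" for k i :: nat
  define y where "y x i = real Q * x i - \<gamma> i" for x :: "nat \<Rightarrow> real" and i
  define P where "P x = (\<Prod>i<n. trig_sq a m (y x i))" for x
  define P' where "P' k x = (\<Prod>i<n. trig_sq (c k i) m (y x i))" for k x
  define G where "G x = \<epsilon> * P x - (\<Sum>k<n. P' k x) / 2" for x
  have P0: "P x \<ge> 0" for x unfolding P_def by (intro prod_nonneg) (auto simp: trig_sq_nonneg)
  have P's: "P' k x = (2 - 2 * cos (2 * pi * y x k)) * P x" if "k < n" for k x
  proof -
    have "trig_sq b m t = (2 - 2 * cos (2 * pi * t)) * trig_sq a m t" for t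
      unfolding b_def[abs_def] m_def by (rule trig_sq_diff) (auto simp: a_def)
    moreover have "P' k x = trig_sq b m (y x k) * (\<Prod>i\<in>{..<n} - {k}. trig_sq a m (y x i))"
      unfolding P'_def using that by (subst prod.remove[of _ k]) (auto simp: c_def)
    moreover have "P x = trig_sq a m (y x k) * (\<Prod>i\<in>{..<n} - {k}. trig_sq a m (y x i))"
      unfolding P_def using that by (subst prod.remove[of _ k]) auto
    ultimately show ?thesis by simp
  qed
  have G: "G x = (\<epsilon> - (\<Sum>k<n. 1 - cos (2 * pi * y x k))) * P x" for x
  proof -
    have "(\<Sum>k<n. P' k x) / 2 = (\<Sum>k<n. 1 - cos (2 * pi * y x k)) * P x"
      unfolding sum_divide_distrib sum_distrib_right
      by (intro sum.cong) (simp_all add: P's left_diff_distrib diff_divide_distrib)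
    then show ?thesis by (simp add: G_def left_diff_distrib)
  qed
  have int: "integrable \<mu> P" "integrable \<mu> (P' k)" for k
    unfolding P_def P'_def y_def by (intro integrable_prod_trig_sq \<mu>)+
  then have intG: "integrable \<mu> G" unfolding G_def by auto
  have upper: "G x \<le> \<epsilon> * (s\<^sup>2) ^ n * indicator ?A x" if "x \<in> space \<mu>" for x
  proof (cases "x \<in> ?A")
    case True
    have "P x \<le> (\<Prod>i<n. s\<^sup>2)"
      unfolding P_def s_def by (intro prod_mono) (auto simp: trig_sq_nonneg trig_sq_le)
    moreover have "(\<Sum>k<n. 1 - cos (2 * pi * y x k)) \<ge> 0" by (intro sum_nonneg) auto
    ultimately have "(\<epsilon> - (\<Sum>k<n. 1 - cos (2 * pi * y x k))) * P x \<le> \<epsilon> * (s\<^sup>2) ^ n"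
      using P0 \<epsilon> by (intro mult_mono) auto
    with True show ?thesis by (simp add: G)
  next
    case False
    have "x \<in> space (Rn n)" using that sets_eq_imp_space_eq[OF \<mu>(2)] by simp
    from not_near_latticeD[OF this False \<delta>(1)]
    have "\<epsilon> - (\<Sum>k<n. 1 - cos (2 * pi * y x k)) \<le> 0" by (simp add: y_def \<epsilon>_def)
    then have "G x \<le> 0" unfolding G using P0 by (rule mult_nonpos_nonneg)
    with False show ?thesis by simp
  qed
  have "(LINT x|\<mu>. G x) \<le> (LINT x|\<mu>. \<epsilon> * (s\<^sup>2) ^ n * indicator ?A x)"
    using A by (intro integral_mono intG upper)
      (auto intro!: integrable_real_indicator simp: less_top[symmetric])
  also have "\<dots> = \<epsilon> * (s\<^sup>2) ^ n * measure \<mu> ?A"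
    using A by (simp add: Int_absorb1 sets.sets_into_space)
  finally have up: "(LINT x|\<mu>. G x) \<le> \<epsilon> * (s\<^sup>2) ^ n * measure \<mu> ?A" .
  have IP: "(LINT x|\<mu>. P x) \<ge> Na ^ n * (1 - S)"
    using integral_prod_trig_sq[OF \<mu> Q R', of "\<lambda>_. a" \<gamma>]
    by (simp add: P_def y_def S_def Na_def algebra_simps abs_le_iff)
  have IP': "(LINT x|\<mu>. P' k x) \<le> Nb * Na ^ (n - 1) * (1 + S)" if "k < n" for k
  proof -
    have "(\<Prod>i<n. \<Sum>j<m. (c k i j)\<^sup>2) = Nb * Na ^ (n - 1)"
      using that by (subst prod.remove[of _ k]) (auto simp: c_def Na_def Nb_def)
    then show ?thesis
      using integral_prod_trig_sq[OF \<mu> Q R', of "c k" \<gamma>]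
      by (simp add: P'_def y_def S_def algebra_simps abs_le_iff)
  qed
  have S: "S \<ge> 0" unfolding S_def by (intro sum_nonneg) auto
  have "2 / 3 * \<epsilon> * Na ^ n * (1 - 2 * S) \<le> (LINT x|\<mu>. G x)"
  proof -
    have "3 * real n * Nb * (Na ^ (n - 1) * (1 + S) / 6) \<le> 2 * \<epsilon> * Na * (Na ^ (n - 1) * (1 + S) / 6)"
      using gap S Na0 by (intro mult_right_mono) auto
    also have "Na * Na ^ (n - 1) = Na ^ n" using n by (simp add: power_eq_if)
    then have "2 * \<epsilon> * Na * (Na ^ (n - 1) * (1 + S) / 6) = \<epsilon> * Na ^ n * (1 + S) / 3"
      by (simp add: mult_ac)
    finally have *: "real n * (Nb * Na ^ (n - 1) * (1 + S)) / 2 \<le> \<epsilon> * Na ^ n * (1 + S) / 3"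
      by (simp add: mult_ac)
    have "(\<Sum>k<n. LINT x|\<mu>. P' k x) \<le> (\<Sum>k<n. Nb * Na ^ (n - 1) * (1 + S))"
      by (intro sum_mono IP') auto
    moreover have "\<epsilon> * (LINT x|\<mu>. P x) \<ge> \<epsilon> * (Na ^ n * (1 - S))"
      using IP \<epsilon> by (intro mult_left_mono) auto
    moreover have "(LINT x|\<mu>. G x) = \<epsilon> * (LINT x|\<mu>. P x) - (\<Sum>k<n. LINT x|\<mu>. P' k x) / 2"
      unfolding G_def using int by simp
    ultimately have "(LINT x|\<mu>. G x) \<ge> \<epsilon> * (Na ^ n * (1 - S)) - \<epsilon> * Na ^ n * (1 + S) / 3"
      using * by simp
    also have "\<epsilon> * (Na ^ n * (1 - S)) - \<epsilon> * Na ^ n * (1 + S) / 3 = 2 / 3 * \<epsilon> * Na ^ n * (1 - 2 * S)"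
      by (simp add: field_simps)
    finally show ?thesis .
  qed
  with up have "\<epsilon> * (2 / 3 * Na ^ n * (1 - 2 * S)) \<le> \<epsilon> * ((s\<^sup>2) ^ n * measure \<mu> ?A)"
    by (simp add: mult_ac)
  with \<epsilon> have main: "2 / 3 * Na ^ n * (1 - 2 * S) \<le> (s\<^sup>2) ^ n * measure \<mu> ?A"
    by (simp only: mult_le_cancel_left_pos)
  show ?thesis
  \<comment> \<open>\<open>Na ^ n\<close> may be replaced by a smaller quantity only if its cofactor
    is nonnegative; otherwise the claimed bound is nonpositive.\<close>
  proof (cases "1 - 2 * S \<ge> 0")
    case True
    \<comment> \<open>The bounds on \<open>Na\<close> and \<open>s\<close> give a ratio of at least
      \<open>1 / (27 * L)\<close>, and \<open>L \<le> 3 * n / \<delta>\<close>.\<close>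
    have "\<delta> / (81 * real n) * s\<^sup>2 \<le> Na"
    proof -
      have "s\<^sup>2 \<le> (3 * (real L)\<^sup>2)\<^sup>2" using s by (intro power_mono) auto
      then have "\<delta> / (81 * real n) * s\<^sup>2 \<le> \<delta> / (81 * real n) * (9 * real L ^ 4)"
        using \<delta> by (intro mult_left_mono) (auto simp: power_mult_distrib)
      also have "\<dots> = (\<delta> * real L / (9 * real n)) * real L ^ 3"
        by (simp add: power_numeral_reduce)
      also have "\<dots> \<le> (1 / 3) * real L ^ 3"
        using L \<delta> n by (intro mult_right_mono) (auto simp: field_simps)
      finally show ?thesis using Na by simp
    qed
    then have "(\<delta> / (81 * real n) * s\<^sup>2) ^ n \<le> Na ^ n"
      using \<delta> by (intro power_mono) auto
    then have "2 / 3 * (\<delta> / (81 * real n) * s\<^sup>2) ^ n * (1 - 2 * S) \<le> 2 / 3 * Na ^ n * (1 - 2 * S)"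
      using True by (intro mult_right_mono mult_left_mono) auto
    with main have "(s\<^sup>2) ^ n * (2 / 3 * (\<delta> / (81 * real n)) ^ n * (1 - 2 * S)) \<le> (s\<^sup>2) ^ n * measure \<mu> ?A"
      unfolding power_mult_distrib by (simp add: mult_ac)
    then show ?thesis using s(2) by (simp add: S_def)
  next
    case False
    then have "2 / 3 * (\<delta> / (81 * real n)) ^ n * (1 - 2 * S) \<le> 0"
      using \<delta> by (intro mult_nonneg_nonpos) auto
    then show ?thesis unfolding S_def using measure_nonneg by (rule order_trans)
  qed
qed

section \<open>Choice of the constants and the split at \<open>K = 9 * n\<^sup>2\<close>\<close>

theorem theorem4p1:
  "\<exists>(A::real)>0. \<exists>B::nat \<Rightarrow> real. (\<forall>N\<ge>1. B N > 0) \<and>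
     (\<forall>n\<ge>1. \<forall>\<mu> :: (nat \<Rightarrow> real) measure.
        prob_space \<mu> \<and> sets \<mu> = sets (Rn n) \<and> (AE x in \<mu>. x \<in> unit_cube n) \<longrightarrow>
        (\<exists>c1>0. \<exists>c2>0. \<forall>\<delta>\<in>{0<..<1}. \<forall>Q\<ge>1. \<forall>K\<ge>1. \<forall>\<gamma>\<in>unit_cube n.
           (\<exists>E1. measure \<mu> (near_lattice n \<delta> Q \<gamma>) \<le> c1 * \<delta> ^ n * (1 + E1) \<and>
                 \<bar>E1\<bar> \<le> A * (\<Sum>\<xi>\<in>freqs n Q (2 * real Q / \<delta>). norm (fourier n \<mu> \<xi>))) \<and>
           (\<exists>E2 E3. measure \<mu> (near_lattice n \<delta> Q \<gamma>) \<ge> c2 * \<delta> ^ n * (1 + E2) + E3 \<and>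
                 \<bar>E2\<bar> \<le> A * (\<Sum>\<xi>\<in>freqs n Q (real K * real Q / \<delta>). norm (fourier n \<mu> \<xi>)) \<and>
                 (\<forall>N\<ge>1. \<bar>E3\<bar> \<le> B N / real K ^ N))))"
proof (rule exI[of _ 2], intro conjI exI[of _ "\<lambda>N. fact N"] allI impI; (elim conjE)?)
  fix n :: nat and \<mu> :: "(nat \<Rightarrow> real) measure"
  assume n: "n \<ge> 1" and \<mu>: "prob_space \<mu>" "sets \<mu> = sets (Rn n)"
  define c1 where "c1 = (96 * real n) ^ n"
  define c where "c = (2/3) * (1 / (81 * real n)) ^ n"
  \<comment> \<open>The exponential ensures \<open>c2 \<le> exp (- K)\<close> whenever
    \<open>K < 9 * n\<^sup>2\<close>; \<open>c\<close> is the constant of the minorant bound, used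
    for larger \<open>K\<close>.\<close>
  define c2 where "c2 = min c (exp (- 9 * (real n)\<^sup>2))"
  have c1: "c1 > 0" and c: "c > 0" using n by (auto simp: c1_def c_def)
  then have c2: "c2 > 0" by (simp add: c2_def)
  show "\<exists>c1>0. \<exists>c2>0. \<forall>\<delta>\<in>{0<..<1}. \<forall>Q\<ge>1. \<forall>K\<ge>1. \<forall>\<gamma>\<in>unit_cube n.
           (\<exists>E1. measure \<mu> (near_lattice n \<delta> Q \<gamma>) \<le> c1 * \<delta> ^ n * (1 + E1) \<and>
                 \<bar>E1\<bar> \<le> 2 * (\<Sum>\<xi>\<in>freqs n Q (2 * real Q / \<delta>). norm (fourier n \<mu> \<xi>))) \<and>
           (\<exists>E2 E3. measure \<mu> (near_lattice n \<delta> Q \<gamma>) \<ge> c2 * \<delta> ^ n * (1 + E2) + E3 \<and>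
                 \<bar>E2\<bar> \<le> 2 * (\<Sum>\<xi>\<in>freqs n Q (real K * real Q / \<delta>). norm (fourier n \<mu> \<xi>)) \<and>
                 (\<forall>N\<ge>1. \<bar>E3\<bar> \<le> fact N / real K ^ N))"
  proof (rule exI[of _ c1], rule conjI[OF c1], rule exI[of _ c2], rule conjI[OF c2], intro conjI ballI allI impI)
    fix \<delta> :: real and Q K :: nat and \<gamma> :: "nat \<Rightarrow> real"
    assume \<delta>: "\<delta> \<in> {0<..<1}" and Q: "Q \<ge> 1" and K: "K \<ge> 1"
    show "\<exists>E1. measure \<mu> (near_lattice n \<delta> Q \<gamma>) \<le> c1 * \<delta> ^ n * (1 + E1) \<and>
                 \<bar>E1\<bar> \<le> 2 * (\<Sum>\<xi>\<in>freqs n Q (2 * real Q / \<delta>). norm (fourier n \<mu> \<xi>))"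
      using measure_near_lattice_le[OF \<mu> n, of \<delta> Q \<gamma>] \<delta> Q
      by (intro exI[of _ "\<Sum>\<xi>\<in>freqs n Q (2 * real Q / \<delta>). norm (fourier n \<mu> \<xi>)"])
         (auto simp: c1_def sum_nonneg)
    define S where "S = (\<Sum>\<xi>\<in>freqs n Q (real K * real Q / \<delta>). norm (fourier n \<mu> \<xi>))"
    have S: "S \<ge> 0" unfolding S_def by (intro sum_nonneg) auto
    have "\<exists>E2 E3. measure \<mu> (near_lattice n \<delta> Q \<gamma>) \<ge> c2 * \<delta> ^ n * (1 + E2) + E3 \<and>
                 \<bar>E2\<bar> \<le> 2 * S \<and> (\<forall>N\<ge>1. \<bar>E3\<bar> \<le> fact N / real K ^ N)"
    proof (cases "real K < 9 * (real n)\<^sup>2")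
      case True
      \<comment> \<open>With \<open>E2 = 0\<close> and \<open>E3 = - c2\<close> the lower bound is
        nonpositive, so only the size of \<open>E3\<close> is at stake.\<close>
      have "c2 * \<delta> ^ n \<le> c2 * 1" using c2 \<delta> by (intro mult_left_mono power_le_one) auto
      then have "c2 * \<delta> ^ n * (1 + 0) + - c2 \<le> 0" by simp
      then have "c2 * \<delta> ^ n * (1 + 0) + - c2 \<le> measure \<mu> (near_lattice n \<delta> Q \<gamma>)"
        using measure_nonneg by (rule order_trans)
      moreover have "\<bar>- c2\<bar> \<le> fact N / real K ^ N" for N
      proof -
        \<comment> \<open>A single term of the exponential series; as \<open>N\<close> is arbitrary,
          one \<open>E3\<close> serves all \<open>N\<close>.\<close>
        have "real K ^ N / fact N \<le> exp (real K)"
          using sum_le_suminf[OF summable_exp[of "real K"], of "{N}"]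
          by (simp add: exp_def divide_inverse mult.commute)
        then have "exp (- real K) \<le> fact N / real K ^ N"
          using K by (simp add: exp_minus field_simps)
        moreover have "c2 \<le> exp (- real K)"
          using True unfolding c2_def by (intro min.coboundedI2) simp
        ultimately show ?thesis using c2 by simp
      qed
      ultimately show ?thesis using S by - (rule exI[of _ 0], rule exI[of _ "- c2"], auto)
    next
      case False
      have "9 * (real n)\<^sup>2 * real Q / \<delta> \<le> real K * real Q / \<delta>"
        using False \<delta> by (intro divide_right_mono mult_right_mono) auto
      from measure_near_lattice_ge[OF \<mu> n _ _ Q this] \<delta>
      have *: "c * \<delta> ^ n * (1 - 2 * S) \<le> measure \<mu> (near_lattice n \<delta> Q \<gamma>)"
        by (simp add: S_def c_def power_divide power_mult_distrib)
      have "c2 * \<delta> ^ n * (1 - 2 * S) \<le> measure \<mu> (near_lattice n \<delta> Q \<gamma>)"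
      proof (cases "1 - 2 * S \<ge> 0")
        case True
        then have "c2 * \<delta> ^ n * (1 - 2 * S) \<le> c * \<delta> ^ n * (1 - 2 * S)"
          using \<delta> by (intro mult_right_mono) (auto simp: c2_def)
        with * show ?thesis by linarith
      next
        case False
        then have "c2 * \<delta> ^ n * (1 - 2 * S) \<le> 0"
          using \<delta> c2 by (intro mult_nonneg_nonpos) auto
        then show ?thesis using measure_nonneg[of \<mu> "near_lattice n \<delta> Q \<gamma>"] by linarith
      qed
      \<comment> \<open>The witness \<open>E2 = - 2 * S\<close> is the source of the constant
        \<open>A = 2\<close>.\<close>
      then show ?thesis using S by - (rule exI[of _ "- 2 * S"], rule exI[of _ 0], auto)
    qed
    then show "\<exists>E2 E3. measure \<mu> (near_lattice n \<delta> Q \<gamma>) \<ge> c2 * \<delta> ^ n * (1 + E2) + E3 \<and>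
                 \<bar>E2\<bar> \<le> 2 * (\<Sum>\<xi>\<in>freqs n Q (real K * real Q / \<delta>). norm (fourier n \<mu> \<xi>)) \<and>
                 (\<forall>N\<ge>1. \<bar>E3\<bar> \<le> fact N / real K ^ N)"
      by (simp add: S_def)
  qed
qed auto

end
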